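(* Let $\boldsymbol{X}=(X_1,\ldots,X_k)\sim SME_k(\boldsymbol{\beta},\underline{\boldsymbol{Q}},\boldsymbol{\alpha})$, where $\beta_j\le\beta_k$ for $j=1,\ldots,k-1$, and let $S=\sum_{j=1}^kX_j$. Then the distribution function of the aggregate risk $S$ is given, for $u\ge0$, by $$F_S(u)=\xi_kF_{S^{(1)}}(u)-\sum_{1\le s<t\le k}\alpha_{s,t}\gamma_s\gamma_t\Big(F_{S_s^{(2)}}(u)+F_{S_t^{(2)}}(u)-F_{S_{s,t}^{(3)}}(u)\Big),$$ where $\xi_k=1+\sum_{1\le s<t\le k}\alpha_{s,t}\gamma_s\gamma_t$, $$S^{(1)}\sim ME\big(2\beta_k,\underline{\Pi}(\Psi(\underline{Q}_1),\ldots,\Psi(\underline{Q}_k))\big),\quad S_{s,t}^{(3)}\sim ME\big(2\beta_k,\underline{\Pi}(\Psi(M_{s,t}(\underline{Q}_1)),\ldots,\Psi(M_{s,t}(\underline{Q}_k)))\big),\quad S_s^{(2)}=S_{s,s}^{(3)},$$ and $$M_{s,t}(\underline{Q}_l)=\begin{cases}V(\underline{Q}_l)&\text{if }l\in\{s,t\},\\ \underline{Q}_l&\text{otherwise.}\end{cases}$$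
   Context: Mixed Erlang: for $\beta>0$, $k\ge1$, $w_k(x,\beta)=\frac{\beta^kx^{k-1}e^{-\beta x}}{(k-1)!}$, $x\ge0$. $ME(\beta,\underline{Q})$, with $\underline{Q}=(q_1,q_2,\ldots)$, $q_k\ge0$, $\sum_kq_k=1$, is the distribution on $[0,\infty)$ with pdf $\sum_{k\ge1}q_kw_k(x,\beta)$. $F_Z$ is the distribution function of $Z$; only the distributions of the auxiliary variables $S^{(1)},S_s^{(2)},S_{s,t}^{(3)}$ matter. Model $SME_k(\boldsymbol{\beta},\underline{\boldsymbol{Q}},\boldsymbol{\alpha})$, $\boldsymbol\beta=(\beta_1,\ldots,\beta_k)$, $\underline{\boldsymbol{Q}}=(\underline{Q}_1,\ldots,\underline{Q}_k)$, $\boldsymbol\alpha=(\alpha_{i,j})_{1\le i<j\le k}$: $X_j\sim ME(\beta_j,\underline{Q}_j)$ with pdf $f_j$, $\gamma_j=\mathbb{E}(f_j(X_j))$ (assumed to exist), $\phi_j(x)=f_j(x)-\gamma_j$, and $(X_1,\ldots,X_k)$ has joint (Sarmanov) pdf $$h(\boldsymbol{x})=\prod_{i=1}^kf_i(x_i)\Big(1+\sum_{1\le j<l\le k}\alpha_{j,l}\phi_j(x_j)\phi_l(x_l)\Big),$$ where the real numbers $\alpha_{j,l}$ are such that the last factor is nonnegative. Transformations of mixing vectors: - $V(\underline{Q})=(v_1,v_2,\ldots)$, $v_m=\dfrac{\sum_{i=1}^m\binom{m-1}{i-1}q_iq_{m+1-i}/2^m}{\sum_{i\ge1}\sum_{j\ge1}\binom{i+j-2}{i-1}q_iq_j/2^{i+j-1}}$;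 $V$ changes the associated scale parameter from $\beta$ to $2\beta$. - $\Psi(\underline{Q})=(\psi_1,\psi_2,\ldots)$ converts a scale $b_1$ into a scale $b_2\ge b_1$: $\psi_m=\sum_{i=1}^mq_i\binom{m-1}{m-i}\big(\frac{b_1}{b_2}\big)^i\big(1-\frac{b_1}{b_2}\big)^{m-i}$ (with $0^0=1$). Here the target is always $b_2=2\beta_k$, and the source scale is $b_1=\beta_l$ when $\Psi$ is applied to $\underline{Q}_l$ and $b_1=2\beta_l$ when it is applied to $V(\underline{Q}_l)$. - $\underline{\Pi}(\underline{Q}_1,\ldots,\underline{Q}_m)=(\pi_1,\pi_2,\ldots)$ is defined iteratively: $\underline{\Pi}(\underline{Q}_1)=\underline{Q}_1$, and $\pi_l(\underline{Q}_1,\ldots,\underline{Q}_{m+1})=0$ for $l=1,\ldots,m$, $\pi_l(\underline{Q}_1,\ldots,\underline{Q}_{m+1})=\sum_{j=m}^{l-1}\pi_j(\underline{Q}_1,\ldots,\underline{Q}_m)\,q_{m+1,l-j}$ for $l\ge m+1$, where $\underline{Q}_i=(q_{i,1},q_{i,2},\ldots)$. *)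

theory Defs
  imports "HOL-Probability.Probability"
begin

text \<open>
  Mixing vectors are functions \<open>nat \<Rightarrow> real\<close> indexed from 1; the value at 0 is never used.
  Risks, scale parameters and families of mixing vectors are likewise indexed by \<open>{1..k}\<close>.
\<close>

definition mixing_vector :: "(nat \<Rightarrow> real) \<Rightarrow> bool" where
  "mixing_vector q \<longleftrightarrow> (\<forall>i\<ge>1. 0 \<le> q i) \<and> (q has_sum 1) {1..}"

text \<open>
  The library's \<open>erlang_density n b\<close> has shape \<open>n + 1\<close> and vanishes on the negative half-line.
\<close>

definition me_pdf :: "real \<Rightarrow> (nat \<Rightarrow> real) \<Rightarrow> real \<Rightarrow> real" where
  "me_pdf b q x = (\<Sum>\<^sub>\<infinity>i\<in>{1..}. q i * erlang_density (i - 1) b x)"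

definition ME :: "real \<Rightarrow> (nat \<Rightarrow> real) \<Rightarrow> real measure" where
  "ME b q = density lborel (\<lambda>x. ennreal (me_pdf b q x))"

text \<open>\<open>me_gamma b q\<close> is the expectation of \<open>f(X)\<close>, where \<open>X\<close> has law \<open>ME b q\<close> and density \<open>f\<close>.\<close>

definition me_gamma :: "real \<Rightarrow> (nat \<Rightarrow> real) \<Rightarrow> real" where
  "me_gamma b q = (\<integral>x. me_pdf b q x \<partial>ME b q)"

definition me_phi :: "real \<Rightarrow> (nat \<Rightarrow> real) \<Rightarrow> real \<Rightarrow> real" where
  "me_phi b q x = me_pdf b q x - me_gamma b q"

definition index_pairs :: "nat \<Rightarrow> (nat \<times> nat) set" where
  "index_pairs k = {(s, t). 1 \<le> s \<and> s < t \<and> t \<le> k}"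

definition sarmanov_factor ::
  "nat \<Rightarrow> (nat \<Rightarrow> real) \<Rightarrow> (nat \<Rightarrow> nat \<Rightarrow> real) \<Rightarrow> (nat \<Rightarrow> nat \<Rightarrow> real) \<Rightarrow> (nat \<Rightarrow> real) \<Rightarrow> real" where
  "sarmanov_factor k \<beta> Q \<alpha> x =
     1 + (\<Sum>(j, l)\<in>index_pairs k. \<alpha> j l * me_phi (\<beta> j) (Q j) (x j) * me_phi (\<beta> l) (Q l) (x l))"

definition sarmanov_pdf ::
  "nat \<Rightarrow> (nat \<Rightarrow> real) \<Rightarrow> (nat \<Rightarrow> nat \<Rightarrow> real) \<Rightarrow> (nat \<Rightarrow> nat \<Rightarrow> real) \<Rightarrow> (nat \<Rightarrow> real) \<Rightarrow> real" where
  "sarmanov_pdf k \<beta> Q \<alpha> x =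
     (\<Prod>i=1..k. me_pdf (\<beta> i) (Q i) (x i)) * sarmanov_factor k \<beta> Q \<alpha> x"

definition SME ::
  "'a measure \<Rightarrow> nat \<Rightarrow> (nat \<Rightarrow> real) \<Rightarrow> (nat \<Rightarrow> nat \<Rightarrow> real) \<Rightarrow> (nat \<Rightarrow> nat \<Rightarrow> real) \<Rightarrow>
   (nat \<Rightarrow> 'a \<Rightarrow> real) \<Rightarrow> bool" where
  "SME M k \<beta> Q \<alpha> X \<longleftrightarrow>
     prob_space M \<and>
     (\<forall>j\<in>{1..k}. 0 < \<beta> j \<and> mixing_vector (Q j) \<and>
        distributed M lborel (X j) (\<lambda>x. ennreal (me_pdf (\<beta> j) (Q j) x)) \<and>
        integrable (ME (\<beta> j) (Q j)) (me_pdf (\<beta> j) (Q j))) \<and>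
     (\<forall>x. (\<forall>i\<in>{1..k}. 0 \<le> x i) \<longrightarrow> 0 \<le> sarmanov_factor k \<beta> Q \<alpha> x) \<and>
     distributed M (\<Pi>\<^sub>M i\<in>{1..k}. lborel) (\<lambda>\<omega>. \<lambda>i\<in>{1..k}. X i \<omega>)
       (\<lambda>x. ennreal (sarmanov_pdf k \<beta> Q \<alpha> x))"

definition V_mix :: "(nat \<Rightarrow> real) \<Rightarrow> nat \<Rightarrow> real" where
  "V_mix q m =
     ((\<Sum>i=1..m. real ((m - 1) choose (i - 1)) * q i * q (m + 1 - i)) / 2 ^ m) /
     (\<Sum>\<^sub>\<infinity>i\<in>{1..}. \<Sum>\<^sub>\<infinity>j\<in>{1..}. real ((i + j - 2) choose (i - 1)) * q i * q j / 2 ^ (i + j - 1))"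

definition Psi_mix :: "real \<Rightarrow> real \<Rightarrow> (nat \<Rightarrow> real) \<Rightarrow> nat \<Rightarrow> real" where
  "Psi_mix b1 b2 q m =
     (\<Sum>i=1..m. q i * real ((m - 1) choose (m - i)) * (b1 / b2) ^ i * (1 - b1 / b2) ^ (m - i))"

text \<open>
  \<open>Pi_mix n Q\<close> combines \<open>Q 1, \<dots>, Q n\<close>; the value for \<open>n = 0\<close> is a dummy.
\<close>

fun Pi_mix :: "nat \<Rightarrow> (nat \<Rightarrow> nat \<Rightarrow> real) \<Rightarrow> nat \<Rightarrow> real" where
  "Pi_mix 0 Q l = 0"
| "Pi_mix (Suc 0) Q l = Q 1 l"
| "Pi_mix (Suc (Suc n)) Q l =
     (let m = Suc n in
       if l \<le> m then 0 else (\<Sum>j=m..l - 1. Pi_mix m Q j * Q (m + 1) (l - j)))"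

text \<open>
  \<open>M_mix\<close> replaces the mixing vectors at positions \<open>s\<close> and \<open>t\<close>; since \<open>V_mix\<close> doubles the
  scale, \<open>M_scale\<close> gives the scale that goes with each vector of the modified family.
\<close>

definition M_mix :: "nat \<Rightarrow> nat \<Rightarrow> (nat \<Rightarrow> nat \<Rightarrow> real) \<Rightarrow> nat \<Rightarrow> nat \<Rightarrow> real" where
  "M_mix s t Q l = (if l \<in> {s, t} then V_mix (Q l) else Q l)"

definition M_scale :: "nat \<Rightarrow> nat \<Rightarrow> (nat \<Rightarrow> real) \<Rightarrow> nat \<Rightarrow> real" where
  "M_scale s t \<beta> l = (if l \<in> {s, t} then 2 * \<beta> l else \<beta> l)"

definition mix1 :: "nat \<Rightarrow> (nat \<Rightarrow> real) \<Rightarrow> (nat \<Rightarrow> nat \<Rightarrow> real) \<Rightarrow> nat \<Rightarrow> real" where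
  "mix1 k \<beta> Q = Pi_mix k (\<lambda>l. Psi_mix (\<beta> l) (2 * \<beta> k) (Q l))"

definition mix3 :: "nat \<Rightarrow> (nat \<Rightarrow> real) \<Rightarrow> (nat \<Rightarrow> nat \<Rightarrow> real) \<Rightarrow> nat \<Rightarrow> nat \<Rightarrow> nat \<Rightarrow> real" where
  "mix3 k \<beta> Q s t = Pi_mix k (\<lambda>l. Psi_mix (M_scale s t \<beta> l) (2 * \<beta> k) (M_mix s t Q l))"

definition mix2 :: "nat \<Rightarrow> (nat \<Rightarrow> real) \<Rightarrow> (nat \<Rightarrow> nat \<Rightarrow> real) \<Rightarrow> nat \<Rightarrow> nat \<Rightarrow> real" where
  "mix2 k \<beta> Q s = mix3 k \<beta> Q s s"

definition sme_xi ::
  "nat \<Rightarrow> (nat \<Rightarrow> real) \<Rightarrow> (nat \<Rightarrow> nat \<Rightarrow> real) \<Rightarrow> (nat \<Rightarrow> nat \<Rightarrow> real) \<Rightarrow> real" where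
  "sme_xi k \<beta> Q \<alpha> =
     1 + (\<Sum>(s, t)\<in>index_pairs k. \<alpha> s t * me_gamma (\<beta> s) (Q s) * me_gamma (\<beta> t) (Q t))"

end

theory Submission
  imports Defs
begin

text \<open>
  The Sarmanov density is the product \<open>F\<close> of the marginal densities times a polynomial in these
  densities. Expanding the polynomial writes it as a signed combination of products of
  univariate densities, \<open>F\<close> itself and variants of \<open>F\<close> in which one or two marginals \<open>f\<close> are
  replaced by the probability density \<open>f\<^sup>2 / \<gamma>\<close> (\<open>sarmanov_pdf_decomposition\<close>). Each product
  is the joint density of independent variables, so integrating over the half-space where the
  coordinates sum to at most \<open>u\<close> gives the distribution function of a sum of independent
  variables. What remains is that each of these sums is mixed Erlang with the announced weights.

  Three closure properties of mixed Erlang laws give this, all by summing a double series along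
  antidiagonals. The normalized square of a mixed Erlang density is mixed Erlang with doubled scale
  and weights \<open>V_mix\<close> (\<open>me_pdf_V_mix\<close>), because the product of two Erlang densities is a multiple of
  an Erlang density with doubled scale. A mixed Erlang density can be rewritten with any larger scale,
  the weights becoming \<open>Psi_mix\<close> (\<open>me_pdf_Psi_mix\<close>), by expanding an exponential factor; this brings all
  summands to the common scale \<open>2 * \<beta> k\<close>, which is large enough because \<open>\<beta> k\<close> is the largest of
  the original scales. Finally, at a common scale Erlang shapes add under convolution, so sums of
  independent variables have the weights \<open>Pi_mix\<close> (\<open>distr_PiM_ME_sum\<close>).
\<close>

(* The side condition of this rule is about the very sum that it rewrites, so that rewriting
   with it blows up on series that are not visibly finite. *)
declare suminf_ennreal [simp del]

section \<open>Sums indexed from 1 and antidiagonal summation\<close>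

text \<open>
  Mixing vectors are indexed from 1 and summed with \<open>has_sum\<close>, whereas the interchange of sums and
  integrals requires no summability conditions for series of extended nonnegative reals over all of
  \<open>nat\<close>. This equivalence moves between the two.
\<close>
lemma has_sum_from_1_iff:
  fixes f :: "nat \<Rightarrow> real"
  assumes "\<And>i. i \<ge> 1 \<Longrightarrow> f i \<ge> 0" "c \<ge> 0"
  shows "(f has_sum c) {1..} \<longleftrightarrow> (\<Sum>n. ennreal (f (Suc n))) = ennreal c"
proof -
  have "n \<in> range Suc" if "n \<ge> 1" for n
    using that by (cases n) auto
  then have range: "{1..} = range Suc"
    by auto
  then have "(f has_sum c) {1..} \<longleftrightarrow> (f has_sum c) (range Suc)"
    by simp
  also have "\<dots> \<longleftrightarrow> ((f \<circ> Suc) has_sum c) UNIV"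
    by (rule has_sum_reindex) auto
  also have "\<dots> \<longleftrightarrow> (f \<circ> Suc) sums c"
    using assms has_sum_imp_sums[of "f \<circ> Suc" c] sums_nonneg_imp_has_sum[of "f \<circ> Suc" c] by auto
  also have "\<dots> \<longleftrightarrow> (\<lambda>n. ennreal ((f \<circ> Suc) n)) sums ennreal c"
    using assms by (subst sums_ennreal) auto
  also have "\<dots> \<longleftrightarrow> (\<Sum>n. ennreal (f (Suc n))) = ennreal c"
    by (simp add: sums_iff)
  finally show ?thesis .
qed

lemma ennreal_infsum_from_1:
  fixes f :: "nat \<Rightarrow> real"
  assumes "\<And>i. i \<ge> 1 \<Longrightarrow> f i \<ge> 0" "f summable_on {1..}"
  shows "ennreal (\<Sum>\<^sub>\<infinity>i\<in>{1..}. f i) = (\<Sum>n. ennreal (f (Suc n)))"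
proof -
  have "(f has_sum (\<Sum>\<^sub>\<infinity>i\<in>{1..}. f i)) {1..}"
    using assms(2) by (rule has_sum_infsum)
  moreover have "(\<Sum>\<^sub>\<infinity>i\<in>{1..}. f i) \<ge> 0"
    by (rule infsum_nonneg) (use assms in auto)
  ultimately show ?thesis
    using has_sum_from_1_iff[of f "\<Sum>\<^sub>\<infinity>i\<in>{1..}. f i"] assms(1) by metis
qed

lemma mixing_vector_iff:
  assumes "\<And>i. i \<ge> 1 \<Longrightarrow> q i \<ge> 0"
  shows "mixing_vector q \<longleftrightarrow> (\<Sum>n. ennreal (q (Suc n))) = 1"
  using has_sum_from_1_iff[of q 1] assms by (simp add: mixing_vector_def)

text \<open>
  All three transformations of mixing vectors are instances of this rearrangement: in each of them
  the term with shapes \<open>i + 1\<close> and \<open>j + 1\<close> contributes to a shape that depends on \<open>i + j\<close> only.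
\<close>
lemma suminf_ennreal_antidiagonal:
  fixes g :: "nat \<Rightarrow> nat \<Rightarrow> ennreal"
  shows "(\<Sum>i. \<Sum>j. g i j) = (\<Sum>m. \<Sum>i\<le>m. g i (m - i))"
proof -
  let ?h = "\<lambda>i m. if i \<le> m then g i (m - i) else 0"
  have "(\<Sum>j. g i j) = (\<Sum>m. ?h i m)" for i
    by (subst suminf_offset[of _ i]) auto
  then have "(\<Sum>i. \<Sum>j. g i j) = (\<Sum>i. \<Sum>m. ?h i m)"
    by simp
  also have "\<dots> = (\<Sum>i. \<integral>\<^sup>+m. ?h i m \<partial>count_space UNIV)"
    by (simp add: nn_integral_count_space_nat)
  also have "\<dots> = (\<integral>\<^sup>+m. (\<Sum>i. ?h i m) \<partial>count_space UNIV)"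
    by (rule nn_integral_suminf[symmetric]) simp
  also have "\<dots> = (\<Sum>m. \<Sum>i. ?h i m)"
    by (simp add: nn_integral_count_space_nat)
  also have "\<dots> = (\<Sum>m. \<Sum>i\<le>m. g i (m - i))"
    by (intro suminf_cong, subst suminf_finite[of "{..m}" for m]) auto
  finally show ?thesis .
qed

lemma suminf_ennreal_mult:
  fixes f g :: "nat \<Rightarrow> ennreal"
  shows "(\<Sum>i. f i) * (\<Sum>j. g j) = (\<Sum>i. \<Sum>j. f i * g j)"
  by simp

section \<open>Erlang mixtures as countable sums of extended reals\<close>

text \<open>
  The mixed Erlang density with values in \<open>ennreal\<close> and with the summation index shifted to start at
  0. Being a series of nonnegative terms it makes sense for every weight sequence, so that identities
  between densities can be shown before the weights are known to sum to 1.
\<close>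
definition erlang_mixture :: "real \<Rightarrow> (nat \<Rightarrow> real) \<Rightarrow> real \<Rightarrow> ennreal" where
  "erlang_mixture b q x = (\<Sum>n. ennreal (q (Suc n)) * ennreal (erlang_density n b x))"

lemma measurable_erlang_mixture [measurable]: "erlang_mixture b q \<in> borel_measurable borel"
  unfolding erlang_mixture_def by measurable

text \<open>
  Each Erlang density has mass 1, so the total mass of a mixture is the sum of its weights. This is
  how a transformed vector with nonnegative entries is recognised as a mixing vector: it suffices to
  know the total mass of the mixture that it defines.
\<close>
lemma nn_integral_erlang_mixture:
  assumes "b > 0"
  shows "(\<integral>\<^sup>+x. erlang_mixture b q x \<partial>lborel) = (\<Sum>n. ennreal (q (Suc n)))"
proof -
  have "(\<integral>\<^sup>+x. ennreal (erlang_density n b x) \<partial>lborel) = 1" for n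
    using nn_integral_erlang_ith_moment[OF assms, of n 0] by simp
  then show ?thesis
    unfolding erlang_mixture_def by (subst nn_integral_suminf) (auto simp: nn_integral_cmult)
qed

lemma mixing_vector_nonneg: "mixing_vector q \<Longrightarrow> i \<ge> 1 \<Longrightarrow> 0 \<le> q i"
  by (simp add: mixing_vector_def)

lemma mixing_vector_le_1:
  assumes "mixing_vector q" "i \<ge> 1"
  shows "q i \<le> 1"
proof -
  have "(q has_sum q i) {i}"
    using has_sum_finite[of "{i}" q] by simp
  moreover have "(q has_sum 1) {1..}"
    using assms by (simp add: mixing_vector_def)
  ultimately show ?thesis
    by (rule has_sum_mono2) (use assms in \<open>auto simp: mixing_vector_def\<close>)
qed

lemma erlang_density_eq_poisson:
  assumes "x \<ge> 0"
  shows "erlang_density n b x = b * exp (- b * x) * ((b * x) ^ n / fact n)"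
  using assms by (simp add: erlang_density_def power_mult_distrib)

text \<open>
  As a function of the shape, the Erlang density is a multiple of the exponential series. As mixing
  weights are at most 1, this dominates the series that defines \<open>me_pdf\<close>.
\<close>
lemma summable_erlang_density: "summable (\<lambda>n. erlang_density n b x)"
proof (cases "x < 0")
  case False
  have "summable (\<lambda>n. (b * x) ^ n / fact n)"
    using summable_exp[of "b * x"] by (simp add: field_simps)
  then have "summable (\<lambda>n. b * exp (- b * x) * ((b * x) ^ n / fact n))"
    by (rule summable_mult)
  then show ?thesis
    using False by (simp only: erlang_density_eq_poisson not_less)
qed (simp add: erlang_density_def)

lemma ennreal_me_pdf:
  assumes "mixing_vector q" "b > 0"
  shows "ennreal (me_pdf b q x) = erlang_mixture b q x"
proof -
  let ?f = "\<lambda>i. q i * erlang_density (i - 1) b x"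
  have nonneg: "?f i \<ge> 0" if "i \<ge> 1" for i
    using assms that by (simp add: mixing_vector_nonneg)
  have "summable (\<lambda>n. ?f (Suc n))"
  proof (rule summable_comparison_test'[OF summable_erlang_density[of b x]])
    show "norm (?f (Suc n)) \<le> erlang_density n b x" if "n \<ge> 0" for n
      using mixing_vector_le_1[OF assms(1), of "Suc n"] mixing_vector_nonneg[OF assms(1), of "Suc n"]
        assms(2) by (simp add: abs_mult mult_left_le_one_le)
  qed
  then have "(?f has_sum (\<Sum>n. ?f (Suc n))) {1..}"
    using nonneg nonneg[of "Suc _"]
    by (subst has_sum_from_1_iff) (auto intro!: suminf_nonneg suminf_ennreal2)
  then have "ennreal (me_pdf b q x) = (\<Sum>n. ennreal (?f (Suc n)))"
    unfolding me_pdf_def using nonneg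
    by (intro ennreal_infsum_from_1) (auto simp: summable_on_def)
  then show ?thesis
    using assms by (simp add: erlang_mixture_def ennreal_mult mixing_vector_nonneg)
qed

lemma me_pdf_nonneg:
  assumes "mixing_vector q" "b > 0"
  shows "me_pdf b q x \<ge> 0"
  unfolding me_pdf_def using assms by (intro infsum_nonneg) (simp add: mixing_vector_nonneg)

lemma me_pdf_eq_enn2real:
  assumes "mixing_vector q" "b > 0"
  shows "me_pdf b q x = enn2real (erlang_mixture b q x)"
  using assms by (simp add: ennreal_me_pdf[symmetric] me_pdf_nonneg)

lemma measurable_me_pdf:
  assumes "mixing_vector q" "b > 0"
  shows "me_pdf b q \<in> borel_measurable borel"
  using me_pdf_eq_enn2real[OF assms]
  by (subst measurable_cong[where g = "\<lambda>x. enn2real (erlang_mixture b q x)"]) auto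

lemma ME_eq_density_erlang_mixture:
  assumes "mixing_vector q" "b > 0"
  shows "ME b q = density lborel (erlang_mixture b q)"
  unfolding ME_def using assms by (simp add: ennreal_me_pdf)

lemma sets_ME [simp, measurable_cong]: "sets (ME b q) = sets borel"
  and space_ME [simp]: "space (ME b q) = UNIV"
  by (simp_all add: ME_def)

lemma prob_space_ME:
  assumes "mixing_vector q" "b > 0"
  shows "prob_space (ME b q)"
proof
  have "(\<Sum>n. ennreal (q (Suc n))) = 1"
    using assms by (subst mixing_vector_iff[symmetric]) (auto simp: mixing_vector_nonneg)
  then show "emeasure (ME b q) (space (ME b q)) = 1"
    using assms by (simp add: ME_eq_density_erlang_mixture emeasure_density nn_integral_erlang_mixture)
qed

section \<open>Change of scale\<close>

lemma Psi_mix_Suc: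
  "Psi_mix b1 b2 q (Suc m) =
     (\<Sum>i\<le>m. q (Suc i) * real (m choose (m - i)) * (b1 / b2) ^ Suc i * (1 - b1 / b2) ^ (m - i))"
  unfolding Psi_mix_def
  by (rule sum.reindex_bij_witness[of _ Suc "\<lambda>i. i - 1"]) auto

lemma Psi_mix_nonneg:
  assumes "\<And>i. i \<ge> 1 \<Longrightarrow> q i \<ge> 0" "0 < b1" "b1 \<le> b2"
  shows "Psi_mix b1 b2 q m \<ge> 0"
  unfolding Psi_mix_def using assms by (intro sum_nonneg) auto

text \<open>
  Write \<open>exp (- b1 * x) = exp (- b2 * x) * exp ((b2 - b1) * x)\<close> and expand the second factor into its
  power series: its \<open>d\<close>-th term raises the shape by \<open>d\<close>. The weights form the negative binomial
  distribution of the number of failures before success number \<open>n + 1\<close>, with success probability \<open>b1 / b2\<close>;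
  they are nonnegative because \<open>b1 \<le> b2\<close>.
\<close>
lemma erlang_density_change_scale:
  assumes "0 < b1" "b1 \<le> b2"
  shows "ennreal (erlang_density n b1 x) =
    (\<Sum>d. ennreal (real ((n + d) choose d) * (b1 / b2) ^ Suc n * (1 - b1 / b2) ^ d) *
        ennreal (erlang_density (n + d) b2 x))"
proof (cases "x < 0")
  case False
  then have x: "x \<ge> 0" by simp
  define y where "y = (b2 - b1) * x"
  have y: "y \<ge> 0" using assms x by (simp add: y_def)
  have 1: "real ((n + d) choose d) * (b1 / b2) ^ Suc n * (1 - b1 / b2) ^ d * erlang_density (n + d) b2 x
      = b1 ^ Suc n * x ^ n / fact n * exp (- b2 * x) * (y ^ d / fact d)" for d
  proof -
    have "real ((n + d) choose d) = fact (n + d) / (fact d * fact n)"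
      by (simp add: binomial_fact)
    moreover have "(b1 / b2) ^ Suc n * (1 - b1 / b2) ^ d * b2 ^ Suc (n + d) = b1 ^ Suc n * (b2 - b1) ^ d"
    proof -
      have "(b1 / b2) ^ Suc n * (1 - b1 / b2) ^ d * b2 ^ Suc (n + d) =
          ((b1 / b2) ^ Suc n * b2 ^ Suc n) * ((1 - b1 / b2) ^ d * b2 ^ d)"
        by (simp add: power_add)
      also have "\<dots> = (b1 / b2 * b2) ^ Suc n * ((1 - b1 / b2) * b2) ^ d"
        by (simp only: power_mult_distrib)
      also have "\<dots> = b1 ^ Suc n * (b2 - b1) ^ d"
        using assms by (simp add: left_diff_distrib)
      finally show ?thesis .
    qed
    moreover have "C * A * B * erlang_density (n + d) b2 x =
        C * (A * B * b2 ^ Suc (n + d)) * (x ^ n * x ^ d * exp (- b2 * x)) / fact (n + d)" for A B C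
      using x by (simp add: erlang_density_def power_add)
    ultimately show ?thesis
      by (simp add: y_def power_mult_distrib del: power_Suc) (simp only: mult_ac)
  qed
  have "(\<lambda>d. y ^ d / fact d) sums exp y"
    using exp_converges[of y] by (simp add: field_simps)
  then have "(\<lambda>d. b1 ^ Suc n * x ^ n / fact n * exp (- b2 * x) * (y ^ d / fact d)) sums
      (b1 ^ Suc n * x ^ n / fact n * exp (- b2 * x) * exp y)"
    by (rule sums_mult)
  also have "b1 ^ Suc n * x ^ n / fact n * exp (- b2 * x) * exp y = erlang_density n b1 x"
    using x by (simp add: erlang_density_def y_def mult.assoc exp_add[symmetric] algebra_simps)
  finally have "(\<Sum>d. ennreal (b1 ^ Suc n * x ^ n / fact n * exp (- b2 * x) * (y ^ d / fact d)))
      = ennreal (erlang_density n b1 x)"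
    using assms x y by (intro suminf_ennreal_eq) auto
  then show ?thesis
    unfolding 1[symmetric] using assms by (simp add: ennreal_mult del: power_Suc)
qed (simp add: erlang_density_def)

lemma erlang_mixture_Psi_mix:
  assumes q: "\<And>i. i \<ge> 1 \<Longrightarrow> q i \<ge> 0" and b: "0 < b1" "b1 \<le> b2"
  shows "erlang_mixture b2 (Psi_mix b1 b2 q) x = erlang_mixture b1 q x"
proof -
  let ?c = "\<lambda>n d. real ((n + d) choose d) * (b1 / b2) ^ Suc n * (1 - b1 / b2) ^ d"
  have c: "?c n d \<ge> 0" for n d using b by simp
  have "erlang_mixture b1 q x =
      (\<Sum>n. \<Sum>d. ennreal (q (Suc n)) * (ennreal (?c n d) * ennreal (erlang_density (n + d) b2 x)))"
    unfolding erlang_mixture_def by (subst erlang_density_change_scale[OF b]) simp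
  also have "\<dots> = (\<Sum>m. \<Sum>n\<le>m. ennreal (q (Suc n)) *
      (ennreal (?c n (m - n)) * ennreal (erlang_density (n + (m - n)) b2 x)))"
    by (rule suminf_ennreal_antidiagonal)
  also have "(\<lambda>m. \<Sum>n\<le>m. ennreal (q (Suc n)) *
      (ennreal (?c n (m - n)) * ennreal (erlang_density (n + (m - n)) b2 x))) =
      (\<lambda>m. ennreal (Psi_mix b1 b2 q (Suc m)) * ennreal (erlang_density m b2 x))"
  proof
    fix m
    have "(\<Sum>n\<le>m. ennreal (q (Suc n)) *
      (ennreal (?c n (m - n)) * ennreal (erlang_density (n + (m - n)) b2 x))) =
      (\<Sum>n\<le>m. ennreal (q (Suc n) * ?c n (m - n))) * ennreal (erlang_density m b2 x)"
    proof -
      have *: "ennreal (q (Suc n) * ?c n d) = ennreal (q (Suc n)) * ennreal (?c n d)" for n d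
        by (rule ennreal_mult[OF q c]) simp
      show ?thesis
        unfolding sum_distrib_right by (intro sum.cong refl) (simp only: *, simp add: mult.assoc)
    qed
    also have "(\<Sum>n\<le>m. ennreal (q (Suc n) * ?c n (m - n))) = ennreal (Psi_mix b1 b2 q (Suc m))"
      unfolding Psi_mix_Suc using q b
      by (subst sum_ennreal) (auto intro!: arg_cong[where f=ennreal] sum.cong simp: mult.assoc)
    finally show "(\<Sum>n\<le>m. ennreal (q (Suc n)) *
      (ennreal (?c n (m - n)) * ennreal (erlang_density (n + (m - n)) b2 x))) =
      ennreal (Psi_mix b1 b2 q (Suc m)) * ennreal (erlang_density m b2 x)" .
  qed
  finally show ?thesis by (simp add: erlang_mixture_def)
qed

text \<open>
  A change of scale leaves the density unchanged, hence also its total mass.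
\<close>
lemma mixing_vector_Psi_mix:
  assumes "mixing_vector q" "0 < b1" "b1 \<le> b2"
  shows "mixing_vector (Psi_mix b1 b2 q)"
proof -
  have q: "\<And>i. i \<ge> 1 \<Longrightarrow> q i \<ge> 0" using assms by (simp add: mixing_vector_nonneg)
  have "(\<Sum>n. ennreal (Psi_mix b1 b2 q (Suc n))) = (\<integral>\<^sup>+x. erlang_mixture b2 (Psi_mix b1 b2 q) x \<partial>lborel)"
    using assms by (intro nn_integral_erlang_mixture[symmetric]) simp
  also have "\<dots> = (\<integral>\<^sup>+x. erlang_mixture b1 q x \<partial>lborel)"
    using erlang_mixture_Psi_mix[of q b1 b2] q assms by simp
  also have "\<dots> = 1"
    using assms q mixing_vector_iff[of q] by (simp add: nn_integral_erlang_mixture)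
  finally show ?thesis
    using Psi_mix_nonneg q assms by (subst mixing_vector_iff) auto
qed

lemma me_pdf_Psi_mix:
  assumes "mixing_vector q" "0 < b1" "b1 \<le> b2"
  shows "me_pdf b2 (Psi_mix b1 b2 q) x = me_pdf b1 q x"
  using assms mixing_vector_Psi_mix[OF assms] mixing_vector_nonneg[OF assms(1)]
  by (simp add: me_pdf_eq_enn2real erlang_mixture_Psi_mix)

section \<open>The square of a mixed Erlang density\<close>

text \<open>
  \<open>V_numerator\<close> and \<open>V_normalizer\<close> are the two parts of the fraction \<open>V_mix\<close>. The numerators are the
  weights of the squared density with respect to the doubled scale, up to the factor \<open>b\<close>; the
  normalizer is their sum.
\<close>
definition V_numerator :: "(nat \<Rightarrow> real) \<Rightarrow> nat \<Rightarrow> real" where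
  "V_numerator q m = (\<Sum>i=1..m. real ((m - 1) choose (i - 1)) * q i * q (m + 1 - i)) / 2 ^ m"

definition V_normalizer :: "(nat \<Rightarrow> real) \<Rightarrow> real" where
  "V_normalizer q =
     (\<Sum>\<^sub>\<infinity>i\<in>{1..}. \<Sum>\<^sub>\<infinity>j\<in>{1..}. real ((i + j - 2) choose (i - 1)) * q i * q j / 2 ^ (i + j - 1))"

lemma V_mix_eq: "V_mix q m = V_numerator q m / V_normalizer q"
  by (simp add: V_mix_def V_numerator_def V_normalizer_def)

lemma V_numerator_Suc:
  "V_numerator q (Suc m) =
     (\<Sum>i\<le>m. real (m choose i) / 2 ^ Suc m * (q (Suc i) * q (Suc (m - i))))"
  unfolding V_numerator_def sum_divide_distrib
  by (rule sum.reindex_bij_witness[of _ Suc "\<lambda>i. i - 1"]) (auto simp: Suc_diff_le)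

lemma V_numerator_nonneg:
  assumes "\<And>i. i \<ge> 1 \<Longrightarrow> q i \<ge> 0"
  shows "V_numerator q m \<ge> 0"
  unfolding V_numerator_def using assms by (intro divide_nonneg_nonneg sum_nonneg) auto

lemma ennreal_V_numerator_Suc:
  assumes "\<And>i. i \<ge> 1 \<Longrightarrow> q i \<ge> 0"
  shows "ennreal (V_numerator q (Suc m)) =
    (\<Sum>i\<le>m. ennreal (real ((i + (m - i)) choose i) / 2 ^ Suc (i + (m - i)) * (q (Suc i) * q (Suc (m - i)))))"
  unfolding V_numerator_Suc using assms by (subst sum_ennreal) (auto intro!: arg_cong[where f = ennreal] sum.cong)

text \<open>
  Summing the double series along antidiagonals gives the numerators. The double series of reals
  converges because of \<open>(n choose k) \<le> 2 ^ n\<close>, which bounds its terms by \<open>q i * q j\<close>.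
\<close>
lemma ennreal_V_normalizer:
  assumes "mixing_vector q"
  shows "ennreal (V_normalizer q) = (\<Sum>m. ennreal (V_numerator q (Suc m)))"
proof -
  define g where "g i j = real ((i + j - 2) choose (i - 1)) * q i * q j / 2 ^ (i + j - 1)" for i j
  have q: "q i \<ge> 0" if "i \<ge> 1" for i
    using assms that by (rule mixing_vector_nonneg)
  have q_sum: "(q has_sum 1) {1..}"
    using assms by (simp add: mixing_vector_def)
  have g: "g i j \<ge> 0" if "i \<ge> 1" "j \<ge> 1" for i j
    using q that by (simp add: g_def)
  have g_le: "g i j \<le> q i * q j" if ij: "i \<ge> 1" "j \<ge> 1" for i j
  proof -
    have "(i + j - 2) choose (i - 1) \<le> 2 ^ (i + j - 2)"
      by (rule binomial_le_pow2)
    also have "\<dots> \<le> 2 ^ (i + j - 1)"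
      by (rule power_increasing) auto
    finally have "real ((i + j - 2) choose (i - 1)) \<le> 2 ^ (i + j - 1)"
      by (metis of_nat_le_iff of_nat_numeral of_nat_power)
    then have "real ((i + j - 2) choose (i - 1)) / 2 ^ (i + j - 1) * (q i * q j) \<le> 1 * (q i * q j)"
      using q ij by (intro mult_right_mono) auto
    then show ?thesis
      by (simp add: g_def)
  qed
  have row_sum: "((\<lambda>j. q i * q j) has_sum q i) {1..}" for i
    using has_sum_cmult_right[OF q_sum, of "q i"] by simp
  have row: "g i summable_on {1..}" if "i \<ge> 1" for i
    using row_sum[of i] g g_le that by (intro summable_on_comparison_test[OF _ g_le]) (auto simp: summable_on_def)
  have row_nonneg: "(\<Sum>\<^sub>\<infinity>j\<in>{1..}. g i j) \<ge> 0" if "i \<ge> 1" for i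
    using g that by (intro infsum_nonneg) auto
  have row_le: "(\<Sum>\<^sub>\<infinity>j\<in>{1..}. g i j) \<le> q i" if "i \<ge> 1" for i
  proof -
    have "(\<Sum>\<^sub>\<infinity>j\<in>{1..}. g i j) \<le> (\<Sum>\<^sub>\<infinity>j\<in>{1..}. q i * q j)"
      using row row_sum g_le that by (intro infsum_mono) (auto simp: summable_on_def)
    then show ?thesis using row_sum[of i] by (simp add: infsumI)
  qed
  have "(\<lambda>i. \<Sum>\<^sub>\<infinity>j\<in>{1..}. g i j) summable_on {1..}"
    using q_sum row_nonneg by (intro summable_on_comparison_test[OF _ row_le]) (auto simp: summable_on_def)
  then have "ennreal (V_normalizer q) = (\<Sum>i. ennreal (\<Sum>\<^sub>\<infinity>j\<in>{1..}. g (Suc i) j))"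
    unfolding V_normalizer_def g_def[symmetric] using row_nonneg by (intro ennreal_infsum_from_1) auto
  also have "\<dots> = (\<Sum>i. \<Sum>j. ennreal (g (Suc i) (Suc j)))"
    using row g by (subst ennreal_infsum_from_1) auto
  also have "\<dots> = (\<Sum>m. \<Sum>i\<le>m. ennreal (g (Suc i) (Suc (m - i))))"
    by (rule suminf_ennreal_antidiagonal)
  also have "\<dots> = (\<Sum>m. ennreal (V_numerator q (Suc m)))"
    using q by (simp add: ennreal_V_numerator_Suc g_def mult.assoc)
  finally show ?thesis .
qed

lemma erlang_density_mult:
  "erlang_density i b x * erlang_density j b x =
     b * (real ((i + j) choose i) / 2 ^ Suc (i + j)) * erlang_density (i + j) (2 * b) x"
proof -
  have "real ((i + j) choose i) = fact (i + j) / (fact i * fact j)"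
    by (simp add: binomial_fact)
  then show ?thesis
    by (simp add: erlang_density_def power_mult_distrib power_add exp_add[symmetric] field_simps)
qed

text \<open>
  By the product formula for Erlang densities, the shapes \<open>i + 1\<close> and \<open>j + 1\<close> at scale \<open>b\<close> combine to the
  shape \<open>i + j + 1\<close> at scale \<open>2 * b\<close>; collecting equal shapes yields \<open>V_numerator\<close>.
\<close>
lemma erlang_mixture_square:
  assumes q: "\<And>i. i \<ge> 1 \<Longrightarrow> q i \<ge> 0" and b: "b > 0"
  shows "erlang_mixture b q x * erlang_mixture b q x =
    ennreal b * erlang_mixture (2 * b) (V_numerator q) x"
proof -
  let ?e = "\<lambda>n. ennreal (erlang_density n (2 * b) x)"
  let ?c = "\<lambda>i j. ennreal (real ((i + j) choose i) / 2 ^ Suc (i + j) * (q (Suc i) * q (Suc j)))"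
  have *: "(ennreal (q (Suc i)) * ennreal (erlang_density i b x)) *
      (ennreal (q (Suc j)) * ennreal (erlang_density j b x)) = ennreal b * (?c i j * ?e (i + j))" for i j
  proof -
    have "q (Suc i) * erlang_density i b x * (q (Suc j) * erlang_density j b x) =
        b * (real ((i + j) choose i) / 2 ^ Suc (i + j) * (q (Suc i) * q (Suc j)) * erlang_density (i + j) (2 * b) x)"
      using erlang_density_mult[of i b x j] by (simp add: mult_ac)
    then show ?thesis
      using q b by (simp add: ennreal_mult[symmetric] del: power_Suc)
  qed
  have "erlang_mixture b q x * erlang_mixture b q x = (\<Sum>i. \<Sum>j. ennreal b * (?c i j * ?e (i + j)))"
    unfolding erlang_mixture_def suminf_ennreal_mult * ..
  also have "\<dots> = (\<Sum>m. \<Sum>i\<le>m. ennreal b * (?c i (m - i) * ?e (i + (m - i))))"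
    by (rule suminf_ennreal_antidiagonal)
  also have "\<dots> = (\<Sum>m. ennreal b * ((\<Sum>i\<le>m. ?c i (m - i)) * ?e m))"
    by (simp add: sum_distrib_left sum_distrib_right)
  also have "\<dots> = (\<Sum>m. ennreal b * (ennreal (V_numerator q (Suc m)) * ?e m))"
    using q by (simp only: ennreal_V_numerator_Suc)
  finally show ?thesis by (simp add: erlang_mixture_def)
qed

lemma nn_integral_erlang_mixture_square:
  assumes "mixing_vector q" "b > 0"
  shows "(\<integral>\<^sup>+x. erlang_mixture b q x * erlang_mixture b q x \<partial>lborel) = ennreal (b * V_normalizer q)"
proof -
  have "(\<integral>\<^sup>+x. erlang_mixture b q x * erlang_mixture b q x \<partial>lborel) =
      ennreal b * (\<integral>\<^sup>+x. erlang_mixture (2 * b) (V_numerator q) x \<partial>lborel)"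
    using assms erlang_mixture_square[of q b] by (simp add: mixing_vector_nonneg nn_integral_cmult)
  also have "\<dots> = ennreal b * ennreal (V_normalizer q)"
    using assms by (simp add: nn_integral_erlang_mixture ennreal_V_normalizer)
  finally show ?thesis
    using assms by (simp add: ennreal_mult')
qed

text \<open>
  If the normalizer vanished, the square of the density would have integral 0, and the density
  would vanish almost everywhere instead of having mass 1.
\<close>
lemma V_normalizer_pos:
  assumes "mixing_vector q"
  shows "V_normalizer q > 0"
proof (rule ccontr)
  assume "\<not> V_normalizer q > 0"
  then have "(\<integral>\<^sup>+x. erlang_mixture 1 q x * erlang_mixture 1 q x \<partial>lborel) = 0"
    using nn_integral_erlang_mixture_square[OF assms, of 1] by (simp add: ennreal_neg)
  then have "AE x in lborel. erlang_mixture 1 q x = 0"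
    by (subst (asm) nn_integral_0_iff_AE) auto
  then have "(\<integral>\<^sup>+x. erlang_mixture 1 q x \<partial>lborel) = 0"
    by (subst nn_integral_0_iff_AE) auto
  then show False
    using assms mixing_vector_iff[of q] by (simp add: nn_integral_erlang_mixture mixing_vector_nonneg)
qed

text \<open>
  The expectation of \<open>f(X)\<close> is the integral of \<open>f\<^sup>2\<close>, so the normalizer in \<open>V_mix\<close> is
  that expectation divided by the scale.
\<close>
lemma me_gamma_eq:
  assumes "mixing_vector q" "b > 0"
  shows "me_gamma b q = b * V_normalizer q"
proof -
  note [measurable] = measurable_me_pdf[OF assms]
  have "me_gamma b q = (\<integral>x. me_pdf b q x * me_pdf b q x \<partial>lborel)"
    unfolding me_gamma_def ME_def using assms by (subst integral_density) (auto simp: me_pdf_nonneg)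
  also have "\<dots> = enn2real (\<integral>\<^sup>+x. erlang_mixture b q x * erlang_mixture b q x \<partial>lborel)"
    using assms by (subst integral_eq_nn_integral) (auto simp: me_pdf_nonneg ennreal_mult ennreal_me_pdf)
  also have "\<dots> = b * V_normalizer q"
    using assms V_normalizer_pos[of q] by (simp add: nn_integral_erlang_mixture_square)
  finally show ?thesis .
qed

lemma me_gamma_pos:
  assumes "mixing_vector q" "b > 0"
  shows "me_gamma b q > 0"
  using assms V_normalizer_pos by (simp add: me_gamma_eq)

lemma mixing_vector_V_mix:
  assumes "mixing_vector q"
  shows "mixing_vector (V_mix q)"
proof -
  have nonneg: "V_numerator q i \<ge> 0" for i
    using assms by (intro V_numerator_nonneg) (rule mixing_vector_nonneg)
  have "(\<Sum>n. ennreal (V_mix q (Suc n))) = (\<Sum>n. ennreal (V_numerator q (Suc n)) / ennreal (V_normalizer q))"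
    using V_normalizer_pos[OF assms] nonneg by (simp add: V_mix_eq divide_ennreal)
  also have "\<dots> = ennreal (V_normalizer q) / ennreal (V_normalizer q)"
    using assms by (simp add: ennreal_V_normalizer)
  also have "\<dots> = 1"
    using V_normalizer_pos[OF assms] by (simp add: divide_ennreal)
  finally show ?thesis
    using nonneg V_normalizer_pos[OF assms] by (subst mixing_vector_iff) (auto simp: V_mix_eq)
qed

text \<open>
  The probabilistic meaning of \<open>V_mix\<close>: the law with density \<open>f\<^sup>2 / \<gamma>\<close> is again mixed Erlang.
  This is what turns the Sarmanov factor, a polynomial in the marginal densities, into mixed
  Erlang laws.
\<close>
lemma me_pdf_V_mix:
  assumes "mixing_vector q" "b > 0"
  shows "me_gamma b q * me_pdf (2 * b) (V_mix q) x = me_pdf b q x * me_pdf b q x"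
proof -
  have D: "V_normalizer q > 0"
    using assms by (intro V_normalizer_pos)
  have "V_numerator q i = V_normalizer q * V_mix q i" for i
    using D by (simp add: V_mix_eq)
  then have "erlang_mixture (2 * b) (V_numerator q) x =
      ennreal (V_normalizer q) * erlang_mixture (2 * b) (V_mix q) x"
    using D by (simp add: erlang_mixture_def ennreal_mult' mult.assoc)
  then have "erlang_mixture b q x * erlang_mixture b q x =
      ennreal (me_gamma b q) * erlang_mixture (2 * b) (V_mix q) x"
    using assms D erlang_mixture_square[of q b x]
    by (simp add: mixing_vector_nonneg me_gamma_eq ennreal_mult mult.assoc)
  then show ?thesis
    using assms mixing_vector_V_mix[of q] me_gamma_pos[of q b]
    by (simp add: me_pdf_eq_enn2real flip: enn2real_mult)
      (simp add: enn2real_mult)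
qed

section \<open>Convolution of mixed Erlang laws with a common scale\<close>

text \<open>
  The binary step behind \<open>Pi_mix\<close>. Both indices \<open>j\<close> and \<open>l - j\<close> stay positive, so the result
  vanishes at 1: a sum of two Erlang variables has shape at least 2.
\<close>
definition mixing_convolution :: "(nat \<Rightarrow> real) \<Rightarrow> (nat \<Rightarrow> real) \<Rightarrow> nat \<Rightarrow> real" where
  "mixing_convolution p q l = (\<Sum>j=1..<l. p j * q (l - j))"

lemma ennreal_mixing_convolution:
  assumes p: "\<And>i. i \<ge> 1 \<Longrightarrow> p i \<ge> 0" and q: "\<And>i. i \<ge> 1 \<Longrightarrow> q i \<ge> 0"
  shows "ennreal (mixing_convolution p q (Suc (Suc m))) =
    (\<Sum>i\<le>m. ennreal (p (Suc i)) * ennreal (q (Suc (m - i))))"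
proof -
  have "mixing_convolution p q (Suc (Suc m)) = (\<Sum>i\<le>m. p (Suc i) * q (Suc (m - i)))"
    unfolding mixing_convolution_def
    by (rule sum.reindex_bij_witness[of _ Suc "\<lambda>i. i - 1"]) (auto simp: Suc_diff_le)
  also have "ennreal \<dots> = (\<Sum>i\<le>m. ennreal (p (Suc i)) * ennreal (q (Suc (m - i))))"
    using p q by (subst sum_ennreal[symmetric]) (auto simp: ennreal_mult)
  finally show ?thesis .
qed

text \<open>
  With \<open>w = 1\<close> this computes the total weight of the convolution, with Erlang densities for \<open>w\<close> its density.
\<close>
lemma suminf_ennreal_mixing_convolution:
  assumes p: "\<And>i. i \<ge> 1 \<Longrightarrow> p i \<ge> 0" and q: "\<And>i. i \<ge> 1 \<Longrightarrow> q i \<ge> 0"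
  shows "(\<Sum>n. ennreal (mixing_convolution p q (Suc n)) * w n) =
    (\<Sum>i. \<Sum>j. ennreal (p (Suc i)) * ennreal (q (Suc j)) * w (Suc (i + j)))"
proof -
  have "(\<Sum>n. ennreal (mixing_convolution p q (Suc n)) * w n) =
      (\<Sum>m. ennreal (mixing_convolution p q (Suc (Suc m))) * w (Suc m))"
    by (subst suminf_offset[of _ 1]) (auto simp: mixing_convolution_def)
  also have "\<dots> = (\<Sum>m. \<Sum>i\<le>m. ennreal (p (Suc i)) * ennreal (q (Suc (m - i))) * w (Suc (i + (m - i))))"
    using p q by (simp add: ennreal_mixing_convolution sum_distrib_right)
  also have "\<dots> = (\<Sum>i. \<Sum>j. ennreal (p (Suc i)) * ennreal (q (Suc j)) * w (Suc (i + j)))"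
    by (rule suminf_ennreal_antidiagonal[symmetric])
  finally show ?thesis .
qed

lemma mixing_vector_mixing_convolution:
  assumes "mixing_vector p" "mixing_vector q"
  shows "mixing_vector (mixing_convolution p q)"
proof -
  have p: "i \<ge> 1 \<Longrightarrow> p i \<ge> 0" and q: "i \<ge> 1 \<Longrightarrow> q i \<ge> 0" for i
    using assms by (auto simp: mixing_vector_nonneg)
  have "(\<Sum>n. ennreal (mixing_convolution p q (Suc n))) = (\<Sum>i. ennreal (p (Suc i))) * (\<Sum>j. ennreal (q (Suc j)))"
    using suminf_ennreal_mixing_convolution[of p q "\<lambda>_. 1"] p q by simp
  also have "\<dots> = 1"
    using assms mixing_vector_iff[of p] mixing_vector_iff[of q] p q by simp
  finally show ?thesis
    using p q by (subst mixing_vector_iff) (auto simp: mixing_convolution_def intro!: sum_nonneg)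
qed

text \<open>
  Convolution is bilinear, and convolving two Erlang densities with the same scale adds their shapes.
\<close>
lemma ME_convolution:
  assumes p: "mixing_vector p" and q: "mixing_vector q" and b: "b > 0"
  shows "ME b p \<star> ME b q = ME b (mixing_convolution p q)"
proof -
  have "finite_measure (ME b p)" "finite_measure (ME b q)"
    using assms by (auto intro!: prob_space.finite_measure prob_space_ME)
  then have "ME b p \<star> ME b q =
      density lborel (\<lambda>x. \<integral>\<^sup>+y. erlang_mixture b p (x - y) * erlang_mixture b q y \<partial>lborel)"
    using assms by (simp add: ME_eq_density_erlang_mixture convolution_density)
  also have "(\<lambda>x. \<integral>\<^sup>+y. erlang_mixture b p (x - y) * erlang_mixture b q y \<partial>lborel) =
      erlang_mixture b (mixing_convolution p q)"
  proof
    fix x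
    let ?w = "\<lambda>i j. \<lambda>y. ennreal (erlang_density i b (x - y)) * ennreal (erlang_density j b y)"
    have w: "(\<integral>\<^sup>+y. ?w i j y \<partial>lborel) = ennreal (erlang_density (Suc (i + j)) b x)" for i j
      using fun_cong[OF convolution_erlang_density[OF b, of i j], of x] by simp
    have "(\<integral>\<^sup>+y. erlang_mixture b p (x - y) * erlang_mixture b q y \<partial>lborel) =
        (\<integral>\<^sup>+y. (\<Sum>i. \<Sum>j. ennreal (p (Suc i)) * ennreal (q (Suc j)) * ?w i j y) \<partial>lborel)"
      unfolding erlang_mixture_def suminf_ennreal_mult by (simp only: mult_ac)
    also have "\<dots> = (\<Sum>i. \<Sum>j. ennreal (p (Suc i)) * ennreal (q (Suc j)) * (\<integral>\<^sup>+y. ?w i j y \<partial>lborel))"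
      by (simp add: nn_integral_suminf nn_integral_cmult del: ennreal_suminf_cmult)
    also have "\<dots> = erlang_mixture b (mixing_convolution p q) x"
      unfolding w erlang_mixture_def using p q
      by (subst suminf_ennreal_mixing_convolution) (auto simp: mixing_vector_nonneg)
    finally show "(\<integral>\<^sup>+y. erlang_mixture b p (x - y) * erlang_mixture b q y \<partial>lborel) =
        erlang_mixture b (mixing_convolution p q) x" .
  qed
  finally show ?thesis
    using mixing_vector_mixing_convolution[OF p q] b by (simp add: ME_eq_density_erlang_mixture)
qed

text \<open>
  \<open>Pi_mix\<close> starts its sum at the smallest shape that carries weight, while \<open>mixing_convolution\<close> starts
  at 1. The vanishing of the terms in between reconciles the two.
\<close>
lemma Pi_mix_eq_0: "1 \<le> j \<Longrightarrow> j \<le> n \<Longrightarrow> Pi_mix (Suc n) Q j = 0"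
  by (cases n) auto

lemma Pi_mix_Suc:
  assumes "n \<ge> 1"
  shows "Pi_mix (Suc n) Q = mixing_convolution (Pi_mix n Q) (Q (Suc n))"
proof
  fix l
  obtain m where n: "n = Suc m"
    using assms by (cases n) auto
  show "Pi_mix (Suc n) Q l = mixing_convolution (Pi_mix n Q) (Q (Suc n)) l"
  proof (cases "l \<le> n")
    case True
    then have "mixing_convolution (Pi_mix n Q) (Q (Suc n)) l = 0"
      unfolding mixing_convolution_def n by (intro sum.neutral) (auto simp: Pi_mix_eq_0)
    then show ?thesis
      using True by (simp add: n)
  next
    case False
    have "(\<Sum>j=n..l - 1. Pi_mix n Q j * Q (Suc n) (l - j)) = (\<Sum>j=1..<l. Pi_mix n Q j * Q (Suc n) (l - j))"
      using False by (intro sum.mono_neutral_left) (auto simp: n Pi_mix_eq_0)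
    then show ?thesis
      using False by (simp add: n mixing_convolution_def)
  qed
qed

section \<open>Sums of independent mixed Erlang variables\<close>

text \<open>
  Both sides agree on rectangles, by Tonelli's theorem for finite products.
\<close>
lemma PiM_density_lborel:
  fixes f :: "'i \<Rightarrow> real \<Rightarrow> ennreal"
  assumes I: "finite I"
    and f [measurable]: "\<And>i. i \<in> I \<Longrightarrow> f i \<in> borel_measurable borel"
    and prob: "\<And>i. i \<in> I \<Longrightarrow> prob_space (density lborel (f i))"
  shows "(\<Pi>\<^sub>M i\<in>I. density lborel (f i)) =
    density (\<Pi>\<^sub>M i\<in>I. lborel) (\<lambda>x. \<Prod>i\<in>I. f i (x i))"
proof -
  (* The uniqueness theorem for product measures wants a sigma-finite factor at every index,
     also outside of I. *)
  define N where "N i = (if i \<in> I then density lborel (f i) else lborel)" for i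
  have "sigma_finite_measure (N i)" for i
    using prob by (auto simp: N_def intro!: prob_space_imp_sigma_finite sigma_finite_lborel)
  then interpret N: product_sigma_finite N
    by (simp add: product_sigma_finite_def)
  interpret L: product_sigma_finite "\<lambda>_ :: 'i. lborel :: real measure"
    by unfold_locales
  have meas: "(\<lambda>x. \<Prod>i\<in>I. f i (x i)) \<in> borel_measurable (\<Pi>\<^sub>M i\<in>I. lborel)"
    by measurable
  have "density (\<Pi>\<^sub>M i\<in>I. lborel) (\<lambda>x. \<Prod>i\<in>I. f i (x i)) = PiM I N"
  proof (rule N.PiM_eqI[OF I])
    show "sets (density (\<Pi>\<^sub>M i\<in>I. lborel) (\<lambda>x. \<Prod>i\<in>I. f i (x i))) = sets (PiM I N)"
      by (simp add: N_def cong: sets_PiM_cong)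
  next
    fix A assume "\<And>i. i \<in> I \<Longrightarrow> A i \<in> sets (N i)"
    then have A: "\<And>i. i \<in> I \<Longrightarrow> A i \<in> sets borel"
      by (simp add: N_def)
    have [measurable]: "Pi\<^sub>E I A \<in> sets (\<Pi>\<^sub>M i\<in>I. lborel)"
      using I A by (intro sets_PiM_I_finite) auto
    have "emeasure (density (\<Pi>\<^sub>M i\<in>I. lborel) (\<lambda>x. \<Prod>i\<in>I. f i (x i))) (Pi\<^sub>E I A) =
        (\<integral>\<^sup>+x. (\<Prod>i\<in>I. f i (x i)) * indicator (Pi\<^sub>E I A) x \<partial>(\<Pi>\<^sub>M i\<in>I. lborel))"
      using meas by (intro emeasure_density) auto
    also have "\<dots> = (\<integral>\<^sup>+x. (\<Prod>i\<in>I. f i (x i) * indicator (A i) (x i)) \<partial>(\<Pi>\<^sub>M i\<in>I. lborel))"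
    proof (rule nn_integral_cong)
      fix x :: "'i \<Rightarrow> real" assume "x \<in> space (\<Pi>\<^sub>M i\<in>I. lborel)"
      then have "indicator (Pi\<^sub>E I A) x = (\<Prod>i\<in>I. indicator (A i) (x i) :: ennreal)"
        using I by (auto simp: space_PiM indicator_def PiE_iff prod_zero_iff)
      then show "(\<Prod>i\<in>I. f i (x i)) * indicator (Pi\<^sub>E I A) x = (\<Prod>i\<in>I. f i (x i) * indicator (A i) (x i))"
        by (simp add: prod.distrib)
    qed
    also have "\<dots> = (\<Prod>i\<in>I. \<integral>\<^sup>+x. f i x * indicator (A i) x \<partial>lborel)"
      using I A by (intro L.product_nn_integral_prod) auto
    also have "\<dots> = (\<Prod>i\<in>I. emeasure (N i) (A i))"
      using A by (intro prod.cong) (auto simp: N_def emeasure_density)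
    finally show "emeasure (density (\<Pi>\<^sub>M i\<in>I. lborel) (\<lambda>x. \<Prod>i\<in>I. f i (x i))) (Pi\<^sub>E I A) =
        (\<Prod>i\<in>I. emeasure (N i) (A i))" .
  qed
  also have "PiM I N = (\<Pi>\<^sub>M i\<in>I. density lborel (f i))"
    by (rule PiM_cong) (auto simp: N_def)
  finally show ?thesis by simp
qed

lemma indep_vars_PiM_components:
  fixes N :: "'i \<Rightarrow> 'b measure"
  assumes N: "\<And>i. i \<in> I \<Longrightarrow> prob_space (N i)" and I: "I \<noteq> {}"
  shows "prob_space.indep_vars (PiM I N) N (\<lambda>i x. x i) I"
proof -
  interpret P: prob_space "PiM I N"
    using N by (rule prob_space_PiM)
  have "distr (PiM I N) (PiM I N) (\<lambda>x. \<lambda>i\<in>I. x i) = distr (PiM I N) (PiM I N) (\<lambda>x. x)"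
    by (intro distr_cong) (auto simp: space_PiM PiE_def extensional_restrict)
  also have "\<dots> = (\<Pi>\<^sub>M i\<in>I. distr (PiM I N) (N i) (\<lambda>x. x i))"
    using N by (subst distr_id) (auto intro!: PiM_cong simp: distr_PiM_component)
  finally show ?thesis
    using I by (subst P.indep_vars_iff_distr_eq_PiM') auto
qed

text \<open>
  The coordinates on a product of probability spaces are independent, so their partial sums are
  convolutions, and these are followed step by step by the recursion of \<open>Pi_mix\<close>.
\<close>
lemma distr_PiM_ME_sum:
  assumes k: "k \<ge> 1" and b: "b > 0" and R: "\<And>i. i \<in> {1..k} \<Longrightarrow> mixing_vector (R i)"
  shows "mixing_vector (Pi_mix k R) \<and>
    distr (\<Pi>\<^sub>M i\<in>{1..k}. ME b (R i)) borel (\<lambda>x. \<Sum>i=1..k. x i) = ME b (Pi_mix k R)"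
proof -
  let ?P = "\<Pi>\<^sub>M i\<in>{1..k}. ME b (R i)"
  have ME: "prob_space (ME b (R i))" if "i \<in> {1..k}" for i
    using R b that by (intro prob_space_ME)
  interpret P: prob_space ?P
    using ME by (rule prob_space_PiM)
  have "P.indep_vars (\<lambda>i. ME b (R i)) (\<lambda>i x. x i) {1..k}"
    using ME k by (intro indep_vars_PiM_components) auto
  then have indep: "P.indep_vars (\<lambda>_. borel) (\<lambda>i x. x i) {1..k}"
    by (rule P.indep_vars_compose2[where Y = "\<lambda>_ x. x"]) auto
  have component: "distr ?P borel (\<lambda>x. x i) = ME b (R i)" if "i \<in> {1..k}" for i
  proof -
    have "distr ?P borel (\<lambda>x. x i) = distr ?P (ME b (R i)) (\<lambda>x. x i)"
      by (rule distr_cong) auto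
    also have "\<dots> = ME b (R i)"
      using ME that by (rule distr_PiM_component)
    finally show ?thesis .
  qed
  have meas: "(\<lambda>x. x i) \<in> borel_measurable ?P" if "i \<in> {1..k}" for i
    using indep that by (auto simp: P.indep_vars_def)
  have "n \<le> k \<Longrightarrow> mixing_vector (Pi_mix n R) \<and>
      distr ?P borel (\<lambda>x. \<Sum>i=1..n. x i) = ME b (Pi_mix n R)" if "n \<ge> 1" for n
    using that
  proof (induction n rule: nat_induct_at_least)
    case base
    have "Pi_mix 1 R = R 1"
      by (simp add: fun_eq_iff)
    then show ?case
      using R k component[of 1] by simp
  next
    case (Suc n)
    have IH: "mixing_vector (Pi_mix n R)" "distr ?P borel (\<lambda>x. \<Sum>i=1..n. x i) = ME b (Pi_mix n R)"
      using Suc by auto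
    have R_Suc: "mixing_vector (R (Suc n))"
      using R Suc by simp
    have rv: "(\<lambda>x. x (Suc n)) \<in> borel_measurable ?P" "(\<lambda>x. \<Sum>i=1..n. x i) \<in> borel_measurable ?P"
      using Suc.prems by (auto intro!: borel_measurable_sum meas)
    have "P.indep_var borel (\<lambda>x. x (Suc n)) borel (\<lambda>x. \<Sum>i=1..n. x i)"
      using Suc.prems by (intro P.indep_vars_sum P.indep_vars_subset[OF indep]) auto
    then have "distr ?P borel (\<lambda>x. x (Suc n) + (\<Sum>i=1..n. x i)) = (ME b (R (Suc n)) \<star> ME b (Pi_mix n R))"
      using P.sum_indep_random_variable[OF _ rv] Suc.prems component[of "Suc n"] IH(2) by simp
    also have "\<dots> = (ME b (Pi_mix n R) \<star> ME b (R (Suc n)))"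
      using b IH(1) R_Suc
      by (intro convolution_commutative prob_space.finite_measure prob_space_ME) auto
    also have "\<dots> = ME b (Pi_mix (Suc n) R)"
      using b IH(1) R_Suc Suc.hyps by (simp only: ME_convolution Pi_mix_Suc)
    finally show ?case
      using IH(1) R_Suc Suc.hyps
      by (simp add: Pi_mix_Suc mixing_vector_mixing_convolution add.commute del: Pi_mix.simps)
  qed
  from this[OF k order_refl] show ?thesis .
qed

text \<open>
  The same result in terms of densities. It is stated as a Bochner integral because the Sarmanov density
  is a linear combination of such products with coefficients of either sign.
\<close>
lemma has_bochner_integral_prod_me_pdf:
  assumes k: "k \<ge> 1" and b: "b > 0" and R: "\<And>i. i \<in> {1..k} \<Longrightarrow> mixing_vector (R i)"
  shows "has_bochner_integral (\<Pi>\<^sub>M i\<in>{1..k}. lborel)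
    (\<lambda>x. (\<Prod>i=1..k. me_pdf b (R i) (x i)) * indicator {..u} (\<Sum>i=1..k. x i))
    (cdf (ME b (Pi_mix k R)) u)"
proof (rule has_bochner_integral_nn_integral)
  let ?L = "\<Pi>\<^sub>M i\<in>{1..k}. lborel :: real measure"
  have [measurable]: "me_pdf b (R i) \<in> borel_measurable borel" if "i \<in> {1..k}" for i
    using R b that by (intro measurable_me_pdf)
  have nonneg: "me_pdf b (R i) y \<ge> 0" if "i \<in> {1..k}" for i y
    using R b that by (intro me_pdf_nonneg)
  show "(\<lambda>x. (\<Prod>i=1..k. me_pdf b (R i) (x i)) * indicator {..u} (\<Sum>i=1..k. x i)) \<in> borel_measurable ?L"
    by measurable
  show "AE x in ?L. 0 \<le> (\<Prod>i=1..k. me_pdf b (R i) (x i)) * indicator {..u} (\<Sum>i=1..k. x i)"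
    using nonneg by (intro always_eventually allI mult_nonneg_nonneg prod_nonneg) auto
  show "0 \<le> cdf (ME b (Pi_mix k R)) u"
    by (simp add: cdf_def)
  have mix: "mixing_vector (Pi_mix k R)"
    and sum: "distr (\<Pi>\<^sub>M i\<in>{1..k}. ME b (R i)) borel (\<lambda>x. \<Sum>i=1..k. x i) = ME b (Pi_mix k R)"
    using distr_PiM_ME_sum[OF assms] by auto
  interpret prob_space "ME b (Pi_mix k R)"
    using mix b by (rule prob_space_ME)
  define A where "A = {x \<in> space ?L. (\<Sum>i=1..k. x i) \<le> u}"
  have [measurable]: "A \<in> sets ?L"
    unfolding A_def by measurable
  have dens: "(\<Pi>\<^sub>M i\<in>{1..k}. ME b (R i)) = density ?L (\<lambda>x. \<Prod>i=1..k. ennreal (me_pdf b (R i) (x i)))"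
    unfolding ME_def using R b prob_space_ME[of "R _" b]
    by (intro PiM_density_lborel) (auto simp: ME_def)
  have "(\<integral>\<^sup>+x. ennreal ((\<Prod>i=1..k. me_pdf b (R i) (x i)) * indicator {..u} (\<Sum>i=1..k. x i)) \<partial>?L) =
      (\<integral>\<^sup>+x. (\<Prod>i=1..k. ennreal (me_pdf b (R i) (x i))) * indicator A x \<partial>?L)"
  proof (rule nn_integral_cong)
    fix x assume "x \<in> space ?L"
    moreover have "ennreal (\<Prod>i=1..k. me_pdf b (R i) (x i)) = (\<Prod>i=1..k. ennreal (me_pdf b (R i) (x i)))"
      by (rule prod_ennreal[symmetric]) (rule nonneg)
    ultimately show "ennreal ((\<Prod>i=1..k. me_pdf b (R i) (x i)) * indicator {..u} (\<Sum>i=1..k. x i)) =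
        (\<Prod>i=1..k. ennreal (me_pdf b (R i) (x i))) * indicator A x"
      by (auto simp: A_def split: split_indicator)
  qed
  also have "\<dots> = emeasure (\<Pi>\<^sub>M i\<in>{1..k}. ME b (R i)) A"
    unfolding dens by (rule emeasure_density[symmetric]) measurable
  also have "A = (\<lambda>x. \<Sum>i=1..k. x i) -` {..u} \<inter> space (\<Pi>\<^sub>M i\<in>{1..k}. ME b (R i))"
    by (auto simp: A_def space_PiM)
  also have "emeasure (\<Pi>\<^sub>M i\<in>{1..k}. ME b (R i)) \<dots> =
      emeasure (distr (\<Pi>\<^sub>M i\<in>{1..k}. ME b (R i)) borel (\<lambda>x. \<Sum>i=1..k. x i)) {..u}"
    by (rule emeasure_distr[symmetric]) (auto simp: dens)
  also have "\<dots> = ennreal (cdf (ME b (Pi_mix k R)) u)"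
    unfolding sum by (simp add: cdf_def emeasure_eq_measure)
  finally show "(\<integral>\<^sup>+x. ennreal ((\<Prod>i=1..k. me_pdf b (R i) (x i)) * indicator {..u} (\<Sum>i=1..k. x i)) \<partial>?L) =
      ennreal (cdf (ME b (Pi_mix k R)) u)" .
qed

section \<open>Decomposition of the Sarmanov density\<close>

text \<open>
  The joint density of independent risks in which the marginals at positions \<open>s\<close> and \<open>t\<close> are replaced
  by their normalized squares.
\<close>
definition tilted_pdf ::
  "nat \<Rightarrow> (nat \<Rightarrow> real) \<Rightarrow> (nat \<Rightarrow> nat \<Rightarrow> real) \<Rightarrow> nat \<Rightarrow> nat \<Rightarrow> (nat \<Rightarrow> real) \<Rightarrow> real" where
  "tilted_pdf k \<beta> Q s t x = (\<Prod>i=1..k. me_pdf (M_scale s t \<beta> i) (M_mix s t Q i) (x i))"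

text \<open>
  Replacing \<open>f\<close> by \<open>f\<^sup>2 / \<gamma>\<close> multiplies the joint density by \<open>f / \<gamma>\<close>. The product over the
  set \<open>{s, t}\<close> has a single factor when \<open>s = t\<close>, which covers the variables \<open>S\<^sup>(\<^sup>2\<^sup>)\<close> as well.
\<close>
lemma tilted_pdf_eq:
  assumes \<beta>: "\<And>i. i \<in> {1..k} \<Longrightarrow> \<beta> i > 0" and Q: "\<And>i. i \<in> {1..k} \<Longrightarrow> mixing_vector (Q i)"
    and st: "s \<in> {1..k}" "t \<in> {1..k}"
  shows "tilted_pdf k \<beta> Q s t x =
    (\<Prod>i=1..k. me_pdf (\<beta> i) (Q i) (x i)) *
    (\<Prod>i\<in>{s, t}. me_pdf (\<beta> i) (Q i) (x i) / me_gamma (\<beta> i) (Q i))"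
proof -
  let ?r = "\<lambda>i. me_pdf (\<beta> i) (Q i) (x i) / me_gamma (\<beta> i) (Q i)"
  have "me_pdf (M_scale s t \<beta> i) (M_mix s t Q i) (x i) =
      me_pdf (\<beta> i) (Q i) (x i) * (if i \<in> {s, t} then ?r i else 1)" if "i \<in> {1..k}" for i
    using me_pdf_V_mix[OF Q \<beta>, OF that that, of "x i"] me_gamma_pos[OF Q \<beta>, OF that that]
    by (simp add: M_scale_def M_mix_def field_simps)
  then have "tilted_pdf k \<beta> Q s t x =
      (\<Prod>i=1..k. me_pdf (\<beta> i) (Q i) (x i)) * (\<Prod>i=1..k. if i \<in> {s, t} then ?r i else 1)"
    unfolding tilted_pdf_def prod.distrib[symmetric] by (intro prod.cong) auto
  also have "(\<Prod>i=1..k. if i \<in> {s, t} then ?r i else 1) = (\<Prod>i\<in>{1..k} \<inter> {s, t}. ?r i)"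
    by (rule prod.inter_restrict[symmetric]) simp
  also have "{1..k} \<inter> {s, t} = {s, t}"
    using st by auto
  finally show ?thesis .
qed

text \<open>
  With \<open>F\<close> the product of the marginals, expand
  \<open>F * (f\<^sub>s - \<gamma>\<^sub>s) * (f\<^sub>t - \<gamma>\<^sub>t) = \<gamma>\<^sub>s * \<gamma>\<^sub>t * F * (1 - f\<^sub>s / \<gamma>\<^sub>s - f\<^sub>t / \<gamma>\<^sub>t + f\<^sub>s * f\<^sub>t / (\<gamma>\<^sub>s * \<gamma>\<^sub>t))\<close>.
  The constant terms add up to \<open>sme_xi\<close>, and the others are tilted densities.
\<close>
lemma sarmanov_pdf_decomposition:
  assumes \<beta>: "\<And>i. i \<in> {1..k} \<Longrightarrow> \<beta> i > 0" and Q: "\<And>i. i \<in> {1..k} \<Longrightarrow> mixing_vector (Q i)"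
  shows "sarmanov_pdf k \<beta> Q \<alpha> x =
    sme_xi k \<beta> Q \<alpha> * (\<Prod>i=1..k. me_pdf (\<beta> i) (Q i) (x i)) -
    (\<Sum>(s, t)\<in>index_pairs k. \<alpha> s t * me_gamma (\<beta> s) (Q s) * me_gamma (\<beta> t) (Q t) *
      (tilted_pdf k \<beta> Q s s x + tilted_pdf k \<beta> Q t t x - tilted_pdf k \<beta> Q s t x))"
proof -
  let ?f = "\<lambda>i. me_pdf (\<beta> i) (Q i) (x i)" and ?\<gamma> = "\<lambda>i. me_gamma (\<beta> i) (Q i)"
  let ?F = "\<Prod>i=1..k. ?f i"
  let ?c = "\<lambda>s t. \<alpha> s t * ?\<gamma> s * ?\<gamma> t"
  have "?F * (\<alpha> s t * (?f s - ?\<gamma> s) * (?f t - ?\<gamma> t)) = ?c s t * ?F - ?c s t *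
      (tilted_pdf k \<beta> Q s s x + tilted_pdf k \<beta> Q t t x - tilted_pdf k \<beta> Q s t x)"
    if "(s, t) \<in> index_pairs k" for s t
  proof -
    have st: "s \<in> {1..k}" "t \<in> {1..k}" "s \<noteq> t"
      using that by (auto simp: index_pairs_def)
    then have "?\<gamma> s > 0" "?\<gamma> t > 0"
      using \<beta> Q by (auto intro!: me_gamma_pos)
    moreover have "tilted_pdf k \<beta> Q s s x = ?F * (?f s / ?\<gamma> s)" "tilted_pdf k \<beta> Q t t x = ?F * (?f t / ?\<gamma> t)"
      "tilted_pdf k \<beta> Q s t x = ?F * (?f s / ?\<gamma> s * (?f t / ?\<gamma> t))"
      using st
        tilted_pdf_eq[where \<beta> = \<beta> and Q = Q and k = k and s = s and t = s and x = x]
        tilted_pdf_eq[where \<beta> = \<beta> and Q = Q and k = k and s = t and t = t and x = x]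
        tilted_pdf_eq[where \<beta> = \<beta> and Q = Q and k = k and s = s and t = t and x = x]
        \<beta> Q by simp_all
    ultimately show ?thesis
      by (simp add: field_simps)
  qed
  then have "(\<Sum>(s, t)\<in>index_pairs k. ?F * (\<alpha> s t * (?f s - ?\<gamma> s) * (?f t - ?\<gamma> t))) =
      (\<Sum>(s, t)\<in>index_pairs k. ?c s t * ?F - ?c s t *
      (tilted_pdf k \<beta> Q s s x + tilted_pdf k \<beta> Q t t x - tilted_pdf k \<beta> Q s t x))"
    by (intro sum.cong) auto
  then show ?thesis
    by (simp add: sarmanov_pdf_def sarmanov_factor_def sme_xi_def me_phi_def case_prod_unfold
        sum_subtractf sum_distrib_left sum_distrib_right distrib_left distrib_right)
qed

lemma me_pdf_eq_0: "x < 0 \<Longrightarrow> me_pdf b q x = 0"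
  by (simp add: me_pdf_def erlang_density_def)

text \<open>
  The Sarmanov factor is constrained on the nonnegative orthant only; outside of it one of the marginal
  densities vanishes.
\<close>
lemma sarmanov_pdf_nonneg:
  assumes "SME M k \<beta> Q \<alpha> X"
  shows "sarmanov_pdf k \<beta> Q \<alpha> x \<ge> 0"
proof (cases "\<forall>i\<in>{1..k}. 0 \<le> x i")
  case True
  then show ?thesis
    using assms unfolding SME_def sarmanov_pdf_def
    by (intro mult_nonneg_nonneg prod_nonneg) (auto simp: me_pdf_nonneg)
next
  case False
  then obtain i where "i \<in> {1..k}" "x i < 0"
    by (meson not_le)
  then have "(\<Prod>i=1..k. me_pdf (\<beta> i) (Q i) (x i)) = 0"
    by (intro prod_zero bexI[of _ i] me_pdf_eq_0) auto
  then show ?thesis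
    unfolding sarmanov_pdf_def by (simp only: mult_zero_left order_refl)
qed

section \<open>The distribution of the aggregate risk\<close>

text \<open>
  The event that the aggregate risk is at most \<open>u\<close> is the preimage of a half-space under the risk vector,
  so its probability is the integral of the joint density over that half-space.
\<close>
lemma cdf_sum_SME:
  assumes SME: "SME M k \<beta> Q \<alpha> X"
    and int: "has_bochner_integral (\<Pi>\<^sub>M i\<in>{1..k}. lborel)
      (\<lambda>x. sarmanov_pdf k \<beta> Q \<alpha> x * indicator {..u} (\<Sum>i=1..k. x i)) v"
  shows "cdf (distr M borel (\<lambda>\<omega>. \<Sum>j=1..k. X j \<omega>)) u = v"
proof -
  let ?L = "\<Pi>\<^sub>M i\<in>{1..k}. lborel :: real measure"
  let ?X = "\<lambda>\<omega>. \<lambda>i\<in>{1..k}. X i \<omega>"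
  let ?S = "\<lambda>x :: nat \<Rightarrow> real. \<Sum>i=1..k. x i"
  have D: "distributed M ?L ?X (\<lambda>x. ennreal (sarmanov_pdf k \<beta> Q \<alpha> x))"
    using SME by (simp add: SME_def)
  then have X [measurable]: "?X \<in> measurable M ?L"
    and h [measurable]: "(\<lambda>x. ennreal (sarmanov_pdf k \<beta> Q \<alpha> x)) \<in> borel_measurable ?L"
    and dens: "distr M ?L ?X = density ?L (\<lambda>x. ennreal (sarmanov_pdf k \<beta> Q \<alpha> x))"
    by (auto simp: distributed_def)
  have S [measurable]: "?S \<in> borel_measurable ?L"
    by measurable
  have v: "v \<ge> 0"
    using sarmanov_pdf_nonneg[OF SME] unfolding has_bochner_integral_integral_eq[OF int, symmetric]
    by (intro Bochner_Integration.integral_nonneg) simp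
  have "(\<lambda>\<omega>. \<Sum>j=1..k. X j \<omega>) = ?S \<circ> ?X"
    by (simp add: fun_eq_iff)
  then have "distr M borel (\<lambda>\<omega>. \<Sum>j=1..k. X j \<omega>) = distr (density ?L (\<lambda>x. ennreal (sarmanov_pdf k \<beta> Q \<alpha> x))) borel ?S"
    unfolding dens[symmetric] by (simp only: distr_distr[OF S X])
  then have "emeasure (distr M borel (\<lambda>\<omega>. \<Sum>j=1..k. X j \<omega>)) {..u} =
      emeasure (density ?L (\<lambda>x. ennreal (sarmanov_pdf k \<beta> Q \<alpha> x))) (?S -` {..u} \<inter> space ?L)"
    by (simp add: emeasure_distr)
  also have "\<dots> = (\<integral>\<^sup>+x. ennreal (sarmanov_pdf k \<beta> Q \<alpha> x) * indicator (?S -` {..u} \<inter> space ?L) x \<partial>?L)"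
    by (rule emeasure_density) measurable
  also have "\<dots> = (\<integral>\<^sup>+x. ennreal (sarmanov_pdf k \<beta> Q \<alpha> x * indicator {..u} (?S x)) \<partial>?L)"
    by (intro nn_integral_cong) (auto split: split_indicator)
  also have "\<dots> = ennreal v"
    using int sarmanov_pdf_nonneg[OF SME]
    by (subst nn_integral_eq_integral) (auto simp: has_bochner_integral_iff)
  finally show ?thesis
    using v by (simp add: cdf_def measure_def)
qed

theorem proposition3p7:
  fixes M :: "'a measure" and k :: nat and X :: "nat \<Rightarrow> 'a \<Rightarrow> real"
    and \<beta> :: "nat \<Rightarrow> real" and Q :: "nat \<Rightarrow> nat \<Rightarrow> real" and \<alpha> :: "nat \<Rightarrow> nat \<Rightarrow> real"
  assumes "k \<ge> 1"
    and "SME M k \<beta> Q \<alpha> X"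
    and "\<And>j. j \<in> {1..k-1} \<Longrightarrow> \<beta> j \<le> \<beta> k"
  shows "mixing_vector (mix1 k \<beta> Q) \<and>
    (\<forall>s\<in>{1..k}. mixing_vector (mix2 k \<beta> Q s)) \<and>
    (\<forall>(s, t)\<in>index_pairs k. mixing_vector (mix3 k \<beta> Q s t)) \<and>
    (\<forall>u\<ge>0. cdf (distr M borel (\<lambda>\<omega>. \<Sum>j=1..k. X j \<omega>)) u =
      sme_xi k \<beta> Q \<alpha> * cdf (ME (2 * \<beta> k) (mix1 k \<beta> Q)) u -
      (\<Sum>(s, t)\<in>index_pairs k.
         \<alpha> s t * me_gamma (\<beta> s) (Q s) * me_gamma (\<beta> t) (Q t) *
         (cdf (ME (2 * \<beta> k) (mix2 k \<beta> Q s)) u +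
          cdf (ME (2 * \<beta> k) (mix2 k \<beta> Q t)) u -
          cdf (ME (2 * \<beta> k) (mix3 k \<beta> Q s t)) u)))"
proof -
  let ?L = "\<Pi>\<^sub>M i\<in>{1..k}. lborel :: real measure"
  let ?I = "\<lambda>u x. indicator {..u} (\<Sum>i=1..k. x i :: real) :: real"
  have \<beta>: "\<beta> i > 0" and Q: "mixing_vector (Q i)" if "i \<in> {1..k}" for i
    using assms(2) that by (auto simp: SME_def)
  have \<beta>_le: "\<beta> i \<le> \<beta> k" if "i \<in> {1..k}" for i
    using assms(3)[of i] that by (cases "i = k") auto
  have \<beta>k: "\<beta> k > 0"
    using \<beta> assms(1) by simp
  have scale1: "\<beta> i \<le> 2 * \<beta> k" if "i \<in> {1..k}" for i
    using \<beta>_le[OF that] \<beta>k by simp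
  have scale3: "0 < M_scale s t \<beta> i" "M_scale s t \<beta> i \<le> 2 * \<beta> k" if "i \<in> {1..k}" for s t i
    using \<beta>_le[OF that] \<beta>[OF that] \<beta>k by (auto simp: M_scale_def)
  have M_mix: "mixing_vector (M_mix s t Q i)" if "i \<in> {1..k}" for s t i
    using Q[OF that] by (simp add: M_mix_def mixing_vector_V_mix)

  have R1: "mixing_vector (Psi_mix (\<beta> i) (2 * \<beta> k) (Q i))" if "i \<in> {1..k}" for i
    using that by (intro mixing_vector_Psi_mix Q \<beta> scale1)
  have R3: "mixing_vector (Psi_mix (M_scale s t \<beta> i) (2 * \<beta> k) (M_mix s t Q i))" if "i \<in> {1..k}" for s t i
    using that by (intro mixing_vector_Psi_mix M_mix scale3)
  have mix: "mixing_vector (mix1 k \<beta> Q)" "mixing_vector (mix3 k \<beta> Q s t)" for s t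
    unfolding mix1_def mix3_def
    using distr_PiM_ME_sum[OF assms(1), where b = "2 * \<beta> k" and R = "\<lambda>i. Psi_mix (\<beta> i) (2 * \<beta> k) (Q i)"] R1
      distr_PiM_ME_sum[OF assms(1), where b = "2 * \<beta> k"
        and R = "\<lambda>i. Psi_mix (M_scale s t \<beta> i) (2 * \<beta> k) (M_mix s t Q i)"] R3 \<beta>k
    by auto

  have int1: "has_bochner_integral ?L (\<lambda>x. (\<Prod>i=1..k. me_pdf (\<beta> i) (Q i) (x i)) * ?I u x)
      (cdf (ME (2 * \<beta> k) (mix1 k \<beta> Q)) u)" for u
  proof -
    have "(\<Prod>i=1..k. me_pdf (2 * \<beta> k) (Psi_mix (\<beta> i) (2 * \<beta> k) (Q i)) (x i)) =
        (\<Prod>i=1..k. me_pdf (\<beta> i) (Q i) (x i))" for x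
      by (intro prod.cong refl me_pdf_Psi_mix Q \<beta> scale1)
    then show ?thesis
      using has_bochner_integral_prod_me_pdf[OF assms(1), where b = "2 * \<beta> k" and u = u
          and R = "\<lambda>i. Psi_mix (\<beta> i) (2 * \<beta> k) (Q i)"] R1 \<beta>k
      by (simp add: mix1_def)
  qed
  have int3: "has_bochner_integral ?L (\<lambda>x. tilted_pdf k \<beta> Q s t x * ?I u x)
      (cdf (ME (2 * \<beta> k) (mix3 k \<beta> Q s t)) u)" for s t u
  proof -
    have "(\<Prod>i=1..k. me_pdf (2 * \<beta> k) (Psi_mix (M_scale s t \<beta> i) (2 * \<beta> k) (M_mix s t Q i)) (x i)) =
        tilted_pdf k \<beta> Q s t x" for x
      unfolding tilted_pdf_def by (intro prod.cong refl me_pdf_Psi_mix M_mix scale3)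
    then show ?thesis
      using has_bochner_integral_prod_me_pdf[OF assms(1), where b = "2 * \<beta> k" and u = u
          and R = "\<lambda>i. Psi_mix (M_scale s t \<beta> i) (2 * \<beta> k) (M_mix s t Q i)"] R3 \<beta>k
      by (simp add: mix3_def)
  qed

  (* Multiply the decomposition of the joint density by the indicator of the half-space and integrate
     term by term. *)
  have "cdf (distr M borel (\<lambda>\<omega>. \<Sum>j=1..k. X j \<omega>)) u =
      sme_xi k \<beta> Q \<alpha> * cdf (ME (2 * \<beta> k) (mix1 k \<beta> Q)) u -
      (\<Sum>(s, t)\<in>index_pairs k.
         \<alpha> s t * me_gamma (\<beta> s) (Q s) * me_gamma (\<beta> t) (Q t) *
         (cdf (ME (2 * \<beta> k) (mix2 k \<beta> Q s)) u +
          cdf (ME (2 * \<beta> k) (mix2 k \<beta> Q t)) u -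
          cdf (ME (2 * \<beta> k) (mix3 k \<beta> Q s t)) u))" for u
  proof (rule cdf_sum_SME[OF assms(2)])
    let ?c = "\<lambda>s t. \<alpha> s t * me_gamma (\<beta> s) (Q s) * me_gamma (\<beta> t) (Q t)"
    let ?T = "\<lambda>s t x. tilted_pdf k \<beta> Q s t x * ?I u x"
    have "sarmanov_pdf k \<beta> Q \<alpha> x * ?I u x =
        sme_xi k \<beta> Q \<alpha> * ((\<Prod>i=1..k. me_pdf (\<beta> i) (Q i) (x i)) * ?I u x) -
        (\<Sum>p\<in>index_pairs k. ?c (fst p) (snd p) *
          (?T (fst p) (fst p) x + ?T (snd p) (snd p) x - ?T (fst p) (snd p) x))" for x
      by (subst sarmanov_pdf_decomposition[OF \<beta> Q])
        (auto simp: case_prod_unfold left_diff_distrib distrib_right sum_distrib_right mult.assoc)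
    moreover have "has_bochner_integral ?L (\<lambda>x.
        sme_xi k \<beta> Q \<alpha> * ((\<Prod>i=1..k. me_pdf (\<beta> i) (Q i) (x i)) * ?I u x) -
        (\<Sum>p\<in>index_pairs k. ?c (fst p) (snd p) *
          (?T (fst p) (fst p) x + ?T (snd p) (snd p) x - ?T (fst p) (snd p) x)))
        (sme_xi k \<beta> Q \<alpha> * cdf (ME (2 * \<beta> k) (mix1 k \<beta> Q)) u -
        (\<Sum>p\<in>index_pairs k. ?c (fst p) (snd p) *
          (cdf (ME (2 * \<beta> k) (mix3 k \<beta> Q (fst p) (fst p))) u +
           cdf (ME (2 * \<beta> k) (mix3 k \<beta> Q (snd p) (snd p))) u -
           cdf (ME (2 * \<beta> k) (mix3 k \<beta> Q (fst p) (snd p))) u)))"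
      by (intro has_bochner_integral_diff has_bochner_integral_add has_bochner_integral_sum
          has_bochner_integral_mult_right int1 int3)
    ultimately show "has_bochner_integral ?L (\<lambda>x. sarmanov_pdf k \<beta> Q \<alpha> x * ?I u x)
      (sme_xi k \<beta> Q \<alpha> * cdf (ME (2 * \<beta> k) (mix1 k \<beta> Q)) u -
      (\<Sum>(s, t)\<in>index_pairs k. ?c s t *
         (cdf (ME (2 * \<beta> k) (mix2 k \<beta> Q s)) u +
          cdf (ME (2 * \<beta> k) (mix2 k \<beta> Q t)) u -
          cdf (ME (2 * \<beta> k) (mix3 k \<beta> Q s t)) u)))"
      by (simp add: mix2_def case_prod_unfold)
  qed
  then show ?thesis
    using mix by (auto simp: mix2_def)
qed

end
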